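(* For every $\lambda=(\lambda_1,\dots,\lambda_9)\in\mathbb R_{\ge0}^9$, $$\begin{aligned}H_3(\lambda)=\inf_{\mu,\nu\in\mathbb R}\Bigl[&h(\lambda_1,\ \lambda_2-\nu,\ \lambda_3+\mu-\nu)\\&+h(\lambda_4-\mu,\ \lambda_5,\ \lambda_6-\mu+\nu)\\&+h(\lambda_7+\mu,\ \lambda_8+\nu,\ \lambda_9)\Bigr].\end{aligned}$$
   Context: $\Delta_3^3=\{\alpha\in\mathbb Z_{\ge0}^3:\alpha_1+\alpha_2+\alpha_3=3\}$, $e_1,e_2,e_3$ is the standard basis of $\mathbb R^3$. $\mathcal L_{3,3}^+$ is the set of full-support Lorentzian cubics in three variables: $f=\sum_{\alpha\in\Delta_3^3}c_\alpha x_1^{\alpha_1}x_2^{\alpha_2}x_3^{\alpha_3}/(\alpha_1!\alpha_2!\alpha_3!)$ with all $c_\alpha>0$ such that for each $i\in\{1,2,3\}$ the symmetric matrix $(c_{e_i+e_j+e_k})_{1\le j,k\le3}$ has at most one positive eigenvalue. For $f\in\mathcal L_{3,3}^+$ and $i,j\in\{1,2,3\}$ with $\{j,k,l\}=\{1,2,3\}$ put $$R_{ij}(f)=\frac{c_{e_i+2e_j}\,c_{e_i+e_k+e_l}}{c_{e_i+e_j+e_k}\,c_{e_i+e_j+e_l}},$$ and order these as $(R_1,\dots,R_9)=(R_{11},R_{12},R_{13},R_{21},R_{22},R_{23},R_{31},R_{32},R_{33})$. For $\lambda\in\mathbb R_{\ge0}^9$, $$H_3(\lambda)=\log\sup_{f\in\mathcal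 L_{3,3}^+}\prod_{m=1}^9R_m(f)^{\lambda_m}.$$ The function $h:\mathbb R^3\to(-\infty,+\infty]$ is $h(a,b,c)=\log\sup X^aY^bZ^c$, where the supremum is over all real symmetric $3\times3$ matrices $P=(p_{ij})$ with all entries positive and at most one positive eigenvalue, and $X=\frac{p_{11}p_{23}}{p_{12}p_{13}}$, $Y=\frac{p_{22}p_{13}}{p_{12}p_{23}}$, $Z=\frac{p_{33}p_{12}}{p_{13}p_{23}}$. *)

theory Defs
  imports
    "HOL-Analysis.Analysis"
    "HOL-Library.Poly_Mapping"
    "HOL-Computational_Algebra.Polynomial"
begin

text \<open>
  The indices 1, 2, 3 are the elements of the type 3, in which \<open>3 = 0\<close> and addition is
  modulo 3; likewise the indices 1, ..., 9 are the elements of the type 9.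
\<close>

subsection \<open>Matrices with at most one positive eigenvalue\<close>

definition charpoly :: "real^'n^'n \<Rightarrow> real poly" where
  "charpoly A = det (mat [:0, 1:] - (\<chi> i j. [:A $ i $ j:]))"

text \<open>Eigenvalues are counted with algebraic multiplicity.\<close>

definition at_most_one_pos_eigenvalue :: "real^'n^'n \<Rightarrow> bool" where
  "at_most_one_pos_eigenvalue A \<longleftrightarrow> size (filter_mset (\<lambda>t. 0 < t) (proots (charpoly A))) \<le> 1"

lemma charpoly_root_iff:
  "poly (charpoly A) t = 0 \<longleftrightarrow> (\<exists>v. v \<noteq> 0 \<and> A *v v = t *\<^sub>R v)"
proof -
  have "poly (charpoly A) t = det (mat t - A)"
    by (simp add: charpoly_def det_def poly_sum poly_prod mat_def if_distrib cong: if_cong)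
       (intro sum.cong refl arg_cong2[where f = "(*)"] prod.cong, auto simp: sign_def)
  moreover have "(mat t - A) *v v = t *\<^sub>R v - A *v v" for v
  proof -
    have "mat t *v v = t *\<^sub>R v"
      by (simp add: mat_def matrix_vector_mult_def vec_eq_iff if_distrib[of "\<lambda>x. x * _"]
               cong: if_cong)
    then show ?thesis
      by (simp add: matrix_vector_mult_diff_rdistrib)
  qed
  ultimately show ?thesis
    using invertible_det_nz[of "mat t - A"] matrix_left_invertible_ker[of "mat t - A"]
    by (auto simp: invertible_left_inverse)
qed


subsection \<open>Ternary cubics\<close>

text \<open>A real polynomial in three variables maps each exponent vector to the coefficient of
  its monomial.\<close>

type_synonym poly3 = "nat^3 \<Rightarrow>\<^sub>0 real"

definition Delta33 :: "(nat^3) set" where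
  "Delta33 = {\<alpha>. \<alpha> $ 1 + \<alpha> $ 2 + \<alpha> $ 3 = 3}"

definition ee :: "3 \<Rightarrow> nat^3" where
  "ee i = axis i 1"

text \<open>The normalized coefficient \<open>c\<^sub>\<alpha>\<close> of \<open>f = (\<Sum>\<alpha>. c\<^sub>\<alpha> x\<^sup>\<alpha> / \<alpha>!)\<close>.\<close>

definition ncoeff :: "poly3 \<Rightarrow> nat^3 \<Rightarrow> real" where
  "ncoeff f \<alpha> = (\<Prod>i\<in>UNIV. fact (\<alpha> $ i)) * Poly_Mapping.lookup f \<alpha>"

definition L33_plus :: "poly3 set" where
  "L33_plus = {f. Poly_Mapping.keys f \<subseteq> Delta33 \<and>
     (\<forall>\<alpha>\<in>Delta33. ncoeff f \<alpha> > 0) \<and>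
     (\<forall>i. at_most_one_pos_eigenvalue (\<chi> j k. ncoeff f (ee i + ee j + ee k)))}"

text \<open>\<open>{j, k, l} = {1, 2, 3}\<close> is realized by \<open>k = j + 1\<close>, \<open>l = j + 2\<close> modulo 3; the expression
  is symmetric in \<open>k\<close> and \<open>l\<close>.\<close>

definition Rij :: "poly3 \<Rightarrow> 3 \<Rightarrow> 3 \<Rightarrow> real" where
  "Rij f i j = (let k = j + 1; l = j + 2 in
     ncoeff f (ee i + ee j + ee j) * ncoeff f (ee i + ee k + ee l) /
     (ncoeff f (ee i + ee j + ee k) * ncoeff f (ee i + ee j + ee l)))"

lemma three_cyclic: "{j, j + 1, j + 2} = (UNIV :: 3 set)"
proof -
  have "\<forall>j :: 3. UNIV = {j, j + 1, j + 2}"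
    by (simp add: forall_3 UNIV_3) auto
  then show ?thesis by auto
qed

lemma Rij_eq:
  assumes "{j, k, l} = (UNIV :: 3 set)"
  shows "Rij f i j = ncoeff f (ee i + ee j + ee j) * ncoeff f (ee i + ee k + ee l) /
                   (ncoeff f (ee i + ee j + ee k) * ncoeff f (ee i + ee j + ee l))"
proof -
  have c: "card {j, k, l} = 3" "card {j, j + 1, j + 2} = 3"
    using assms three_cyclic[of j] by simp_all
  have "k \<noteq> l" "k \<noteq> j" "l \<noteq> j"
    using c(1) by (auto simp: card_insert_if split: if_splits)
  moreover have "k \<in> {j, j + 1, j + 2}" "l \<in> {j, j + 1, j + 2}"
    using three_cyclic by auto
  ultimately have "k = j + 1 \<and> l = j + 2 \<or> k = j + 2 \<and> l = j + 1"
    by auto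
  then show ?thesis
    by (auto simp: Rij_def Let_def ac_simps)
qed

definition Rvec :: "poly3 \<Rightarrow> real^9" where
  "Rvec f = vector [Rij f 1 1, Rij f 1 2, Rij f 1 3, Rij f 2 1, Rij f 2 2, Rij f 2 3, Rij f 3 1, Rij f 3 2, Rij f 3 3]"

lemma Rvec_nth:
  "Rvec f $ 1 = Rij f 1 1" "Rvec f $ 2 = Rij f 1 2" "Rvec f $ 3 = Rij f 1 3"
  "Rvec f $ 4 = Rij f 2 1" "Rvec f $ 5 = Rij f 2 2" "Rvec f $ 6 = Rij f 2 3"
  "Rvec f $ 7 = Rij f 3 1" "Rvec f $ 8 = Rij f 3 2" "Rvec f $ 9 = Rij f 3 3"
  by (simp_all add: Rvec_def vector_def)


subsection \<open>The logarithmic suprema\<close>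

definition elog :: "ereal \<Rightarrow> ereal" where
  "elog x = (if x = \<infinity> then \<infinity> else if x \<le> 0 then -\<infinity> else ereal (ln (real_of_ereal x)))"

definition H3 :: "real^9 \<Rightarrow> ereal" where
  "H3 l = elog (SUP f\<in>L33_plus. ereal (\<Prod>m\<in>UNIV. Rvec f $ m powr (l $ m)))"

definition pos_sym_matrices :: "(real^3^3) set" where
  "pos_sym_matrices = {P. transpose P = P \<and> (\<forall>i j. P $ i $ j > 0) \<and> at_most_one_pos_eigenvalue P}"

definition PX :: "real^3^3 \<Rightarrow> real" where
  "PX P = P $ 1 $ 1 * P $ 2 $ 3 / (P $ 1 $ 2 * P $ 1 $ 3)"

definition PY :: "real^3^3 \<Rightarrow> real" where
  "PY P = P $ 2 $ 2 * P $ 1 $ 3 / (P $ 1 $ 2 * P $ 2 $ 3)"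

definition PZ :: "real^3^3 \<Rightarrow> real" where
  "PZ P = P $ 3 $ 3 * P $ 1 $ 2 / (P $ 1 $ 3 * P $ 2 $ 3)"

definition h :: "real \<Rightarrow> real \<Rightarrow> real \<Rightarrow> ereal" where
  "h a b c = elog (SUP P\<in>pos_sym_matrices. ereal (PX P powr a * PY P powr b * PZ P powr c))"

end

theory Submission
  imports Defs
begin

text \<open>
  The formula is Lagrangian duality for maximizing a linear functional over a product of convex sets.

  Write \<open>(u, v, w) = (ln X, ln Y, ln Z)\<close> for the ratios of a matrix in \<^const>\<open>pos_sym_matrices\<close>.
  A monomial in the ratios becomes a linear functional of \<open>(u, v, w)\<close>, so \<^const>\<open>h\<close> is the support
  function of the set \<open>K\<close> of these points (\<open>h_eq_support\<close>). A cubic consists of three such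
  matrices, the slices \<open>(c\<^bsub>e\<^sub>i+e\<^sub>j+e\<^sub>k\<^esub>)\<^bsub>j,k\<^esub>\<close>, which share entries. In the logarithms of the nine ratios
  this sharing amounts to exactly two linear equations,
  \<open>R\<^sub>1\<^sub>3 R\<^sub>3\<^sub>1 = R\<^sub>2\<^sub>1 R\<^sub>2\<^sub>3\<close> and \<open>R\<^sub>3\<^sub>2 R\<^sub>2\<^sub>3 = R\<^sub>1\<^sub>2 R\<^sub>1\<^sub>3\<close>, and every point of \<open>K \<times> K \<times> K\<close>
  that satisfies them comes from a cubic (\<open>log_Rs_image\<close>). Hence \<^const>\<open>H3\<close> is the supremum of a
  linear functional over \<open>K \<times> K \<times> K\<close> subject to two linear constraints, and \<open>\<mu>\<close> and \<open>\<nu>\<close> are the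
  multipliers of the constraints: for fixed multipliers the Lagrangian splits into three
  summands, each of which is maximized over its own copy of \<open>K\<close>.

  Equality of the two values (\<open>lagrange_duality_linear_constraint\<close>) requires that \<open>K\<close> be convex
  and that the constraints be satisfiable with all small perturbations of their right-hand sides.
  The latter holds because \<open>K\<close> contains the negative octant (\<open>gluing_slater\<close>). Convexity is the
  substantial point. Counting the signs of the eigenvalues shows that \<open>K\<close> is cut out by
  \<open>xy, xz, yz \<le> 1\<close> and \<open>x + y + z \<le> xyz + 2\<close>, where \<open>x = e\<^sup>u\<close>, \<open>y = e\<^sup>v\<close>, \<open>z = e\<^sup>w\<close>
  (\<open>log_ratios_image\<close>). Solved for \<open>w\<close>, this is the closure of the region below the graph of
  \<open>ln (2 - x - y) - ln (1 - xy)\<close>, and the second derivatives of this function along lines are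
  nonpositive by an explicit identity (\<open>roof_second_derivative_bound\<close>).
\<close>

section \<open>Lagrangian duality for linear constraints\<close>

text \<open>
  The supremum \<open>V\<close> of the constrained problem is separated from what is attainable: the set of pairs
  \<open>(A u, r)\<close> with \<open>u \<in> K\<close> and \<open>r < g u - V\<close> is convex and misses the origin. A separating hyperplane
  that is not vertical is a multiplier. A vertical one would bound \<open>A ` K\<close> to one
  side of the origin, against the interiority assumption.
\<close>

lemma lagrange_duality_linear_constraint:
  fixes A :: "'a::real_vector \<Rightarrow> 'b::euclidean_space" and g :: "'a \<Rightarrow> real"
  assumes "convex K" and A: "linear A" and g: "linear g"
    and slater: "0 \<in> interior (A ` K)"
  shows "(SUP u\<in>{u\<in>K. A u = 0}. ereal (g u)) = (INF y. SUP u\<in>K. ereal (g u + y \<bullet> A u))"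
    (is "?p = ?d")
proof (rule antisym)
  show "?p \<le> ?d"
    by (intro INF_greatest SUP_least, rule SUP_upper2) auto
next
  obtain u0 where u0: "u0 \<in> K" "A u0 = 0"
    using slater interior_subset[of "A ` K"] by force
  show "?d \<le> ?p"
  proof (cases "?p = \<infinity>")
    case False
    moreover have "ereal (g u0) \<le> ?p"
      using u0 by (intro SUP_upper) auto
    ultimately obtain V where V: "?p = ereal V"
      by (cases ?p) auto
    have le_V: "g u \<le> V" if "u \<in> K" "A u = 0" for u
      using that V SUP_upper[of u "{u\<in>K. A u = 0}" "\<lambda>u. ereal (g u)"] by auto
    define M where "M = {(A u, r) | u r. u \<in> K \<and> r < g u - V}"
    have "convex M"
    proof (rule convexI)
      fix x y :: "'b \<times> real" and s t :: real
      assume xy: "x \<in> M" "y \<in> M" and st: "0 \<le> s" "0 \<le> t" "s + t = 1"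
      from xy obtain u r u' r' where x: "x = (A u, r)" "u \<in> K" "r < g u - V"
        and y: "y = (A u', r')" "u' \<in> K" "r' < g u' - V"
        unfolding M_def by auto
      have "s *\<^sub>R u + t *\<^sub>R u' \<in> K"
        using \<open>convex K\<close> x y st by (simp add: convexD)
      moreover have "s * r + t * r' < s * (g u - V) + t * (g u' - V)"
      proof (cases "s = 0")
        case True
        then show ?thesis using st y by simp
      next
        case False
        then show ?thesis
          using st x y by (intro add_less_le_mono mult_strict_left_mono mult_left_mono) auto
      qed
      then have "s * r + t * r' < g (s *\<^sub>R u + t *\<^sub>R u') - (s + t) * V"
        using g by (simp add: linear_add linear_scale algebra_simps)
      moreover have "s *\<^sub>R x + t *\<^sub>R y = (A (s *\<^sub>R u + t *\<^sub>R u'), s * r + t * r')"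
        using A x y by (simp add: linear_add linear_scale)
      ultimately show "s *\<^sub>R x + t *\<^sub>R y \<in> M"
        using st unfolding M_def by auto
    qed
    moreover have "0 \<notin> M"
      using le_V by (force simp: M_def zero_prod_def)
    ultimately obtain n where "n \<noteq> 0" and n: "\<forall>x\<in>M. 0 \<le> n \<bullet> x"
      using separating_hyperplane_set_0 by blast
    obtain a \<rho> where n_eq: "n = (a, \<rho>)"
      by (cases n)
    have sep: "0 \<le> a \<bullet> A u + \<rho> * r" if "u \<in> K" "r < g u - V" for u r
      using n that unfolding n_eq M_def by (force simp: inner_prod_def)
    have "\<rho> \<le> 0"
    proof (rule ccontr)
      assume "\<not> \<rho> \<le> 0"
      moreover have "0 \<le> \<rho> * (min (g u0 - V) 0 - 1)"
        using sep[of u0 "min (g u0 - V) 0 - 1"] u0 by auto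
      ultimately show False
        by (auto simp: zero_le_mult_iff)
    qed
    moreover have "\<rho> \<noteq> 0"
    proof
      assume "\<rho> = 0"
      then have "a \<noteq> 0"
        using \<open>n \<noteq> 0\<close> n_eq by (auto simp: zero_prod_def)
      have nonneg: "0 \<le> a \<bullet> A u" if "u \<in> K" for u
        using sep[OF that, of "g u - V - 1"] \<open>\<rho> = 0\<close> by simp
      obtain e where e: "e > 0" "ball 0 e \<subseteq> A ` K"
        using slater by (auto simp: mem_interior)
      have "- (e / (2 * norm a)) *\<^sub>R a \<in> A ` K"
        using e \<open>a \<noteq> 0\<close> by (intro subsetD[OF e(2)]) auto
      then have "0 \<le> a \<bullet> (- (e / (2 * norm a)) *\<^sub>R a)"
        using nonneg by force
      then show False
        using e \<open>a \<noteq> 0\<close> inner_gt_zero_iff[of a]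
          by (simp add: mult_le_0_iff divide_le_0_iff del: inner_gt_zero_iff)
    qed
    ultimately have "\<rho> < 0"
      by simp
    have "g u + (a /\<^sub>R \<rho>) \<bullet> A u \<le> V" if "u \<in> K" for u
    proof (rule field_le_epsilon)
      fix e :: real assume "0 < e"
      then have "0 \<le> a \<bullet> A u + \<rho> * (g u - V - e)"
        using sep[OF that] by simp
      then have "(a \<bullet> A u + \<rho> * (g u - V - e)) / \<rho> \<le> 0"
        using \<open>\<rho> < 0\<close> by (simp add: divide_nonneg_neg)
      moreover have "(a \<bullet> A u + \<rho> * (g u - V - e)) / \<rho> = (a /\<^sub>R \<rho>) \<bullet> A u + (g u - V - e)"
      proof -
        have "(a /\<^sub>R \<rho>) \<bullet> A u = (a \<bullet> A u) / \<rho>"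
          by (simp add: divide_inverse_commute)
        then show ?thesis
          using \<open>\<rho> < 0\<close> by (simp add: add_divide_distrib)
      qed
      ultimately show "g u + (a /\<^sub>R \<rho>) \<bullet> A u \<le> V + e"
        by linarith
    qed
    then have "?d \<le> ereal V"
      by (intro INF_lower2[of "a /\<^sub>R \<rho>"] SUP_least) auto
    then show ?thesis
      using V by simp
  qed simp
qed


section \<open>Suprema of exponentials and of separated sums\<close>

lemma elog_mono: "x \<le> y \<Longrightarrow> elog x \<le> elog y"
  by (cases x; cases y) (auto simp: elog_def)

lemma elog_SUP_exp: "elog (SUP i\<in>I. ereal (exp (g i))) = (SUP i\<in>I. ereal (g i))"
proof (rule antisym)
  show "(SUP i\<in>I. ereal (g i)) \<le> elog (SUP i\<in>I. ereal (exp (g i)))"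
  proof (rule SUP_least)
    fix i assume "i \<in> I"
    then have "elog (ereal (exp (g i))) \<le> elog (SUP i\<in>I. ereal (exp (g i)))"
      by (intro elog_mono SUP_upper)
    then show "ereal (g i) \<le> elog (SUP i\<in>I. ereal (exp (g i)))"
      by (simp add: elog_def)
  qed
  show "elog (SUP i\<in>I. ereal (exp (g i))) \<le> (SUP i\<in>I. ereal (g i))"
  proof (cases "SUP i\<in>I. ereal (g i)")
    case (real r)
    then have "g i \<le> r" if "i \<in> I" for i
      using SUP_upper[OF that, of "\<lambda>i. ereal (g i)"] by simp
    then have "elog (SUP i\<in>I. ereal (exp (g i))) \<le> elog (ereal (exp r))"
      by (intro elog_mono SUP_least) auto
    then show ?thesis
      using real by (simp add: elog_def)
  next
    case MInf
    then have "I = {}"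
      using SUP_upper[of _ I "\<lambda>i. ereal (g i)"] by force
    then show ?thesis
      by (simp add: elog_def bot_ereal_def)
  qed simp
qed

lemma SUP_ereal_Times_add:
  fixes p :: "'a \<Rightarrow> real" and q :: "'b \<Rightarrow> real"
  assumes "S \<noteq> {}" "T \<noteq> {}"
  shows "(SUP (u, v)\<in>S \<times> T. ereal (p u + q v)) = (SUP u\<in>S. ereal (p u)) + (SUP v\<in>T. ereal (q v))"
proof -
  have T: "(SUP v\<in>T. ereal (q v)) \<noteq> -\<infinity>"
  proof -
    obtain v where "v \<in> T"
      using assms by auto
    then have "ereal (q v) \<le> (SUP v\<in>T. ereal (q v))"
      by (rule SUP_upper)
    then show ?thesis
      by auto
  qed
  have "(SUP (u, v)\<in>S \<times> T. ereal (p u + q v)) = (SUP u\<in>S. SUP v\<in>T. ereal (p u) + ereal (q v))"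
    by (rule antisym) (auto intro!: SUP_least intro: SUP_upper2)
  also have "\<dots> = (SUP u\<in>S. ereal (p u) + (SUP v\<in>T. ereal (q v)))"
    by (intro SUP_cong refl SUP_ereal_add_right assms) auto
  also have "\<dots> = (SUP u\<in>S. ereal (p u)) + (SUP v\<in>T. ereal (q v))"
    by (intro SUP_ereal_add_left assms T)
  finally show ?thesis .
qed


section \<open>Positive symmetric matrices of order three\<close>

text \<open>
  For \<open>u = ln X\<close>, \<open>v = ln Y\<close>, \<open>w = ln Z\<close>, the first three conditions say that the principal minors of
  order two are at most 0, for example \<open>X Y = p\<^sub>1\<^sub>1 p\<^sub>2\<^sub>2 / p\<^sub>1\<^sub>2\<^sup>2\<close>. The last one says that the
  determinant, divided by \<open>p\<^sub>1\<^sub>2 p\<^sub>1\<^sub>3 p\<^sub>2\<^sub>3\<close>, is at least 0.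
\<close>

definition log_region :: "(real \<times> real \<times> real) set" where
  "log_region = {(u, v, w). u + v \<le> 0 \<and> u + w \<le> 0 \<and> v + w \<le> 0 \<and>
     exp u + exp v + exp w \<le> exp (u + v + w) + 2}"

lemma charpoly_3:
  fixes P :: "real^3^3"
  assumes "transpose P = P"
  defines "a \<equiv> P $ 1 $ 1" and "b \<equiv> P $ 2 $ 2" and "c \<equiv> P $ 3 $ 3"
    and "d \<equiv> P $ 1 $ 2" and "e \<equiv> P $ 1 $ 3" and "f \<equiv> P $ 2 $ 3"
  shows "charpoly P = [:-(a*b*c + 2*d*e*f - a*f^2 - b*e^2 - c*d^2),
           (a*b - d^2) + (a*c - e^2) + (b*c - f^2), -(a + b + c), 1:]"
proof -
  have "transpose P $ j $ i = P $ i $ j" for i j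
    by (simp add: transpose_def)
  then have sym: "P $ i $ j = P $ j $ i" for i j
    using assms(1) by simp
  have entries: "(mat [:0, 1:] - (\<chi> i j. [:P $ i $ j:])) $ i $ j = (if i = j then [:- P $ i $ j, 1:] else [:- P $ i $ j:])"
    for i j
    by (simp add: mat_def)
  have sym': "P $ 2 $ 1 = d" "P $ 3 $ 1 = e" "P $ 3 $ 2 = f"
    unfolding d_def e_def f_def by (rule sym)+
  have ne: "(1::3) \<noteq> 2" "(2::3) \<noteq> 1" "(1::3) \<noteq> 3" "(3::3) \<noteq> 1" "(2::3) \<noteq> 3" "(3::3) \<noteq> 2"
    by simp_all
  have "charpoly P = [:-a, 1:] * [:-b, 1:] * [:-c, 1:] + [:-d:] * [:-f:] * [:-e:] + [:-e:] * [:-d:] * [:-f:]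
      - [:-a, 1:] * [:-f:] * [:-f:] - [:-d:] * [:-d:] * [:-c, 1:] - [:-e:] * [:-b, 1:] * [:-e:]"
    unfolding charpoly_def det_3 entries
    by (simp only: ne if_False if_True refl sym' flip: a_def b_def c_def d_def e_def f_def)
  also have "\<dots> = [:-(a*b*c + 2*d*e*f - a*f^2 - b*e^2 - c*d^2),
           (a*b - d^2) + (a*c - e^2) + (b*c - f^2), -(a + b + c), 1:]"
    by (simp add: algebra_simps power2_eq_square)
  finally show ?thesis .
qed

text \<open>
  All three roots are real by interlacing: at the eigenvalues \<open>\<alpha> < \<beta>\<close> of the trailing block
  \<open>(b, f; f, c)\<close> the characteristic polynomial has values \<open>\<ge> 0\<close> and \<open>< 0\<close> respectively. This gives a
  root beyond \<open>\<beta>\<close>, which is positive because \<open>\<beta> > b\<close>, and the quadratic cofactor is nonpositive at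
  \<open>\<alpha>\<close>, hence splits.
\<close>

lemma interlacing_roots_3:
  fixes a b c d e f :: real
  assumes pos: "b > 0" "c > 0" "d > 0" "e > 0" "f > 0"
  obtains t1 t2 t3 where "t1 > 0"
    "[:-(a*b*c + 2*d*e*f - a*f^2 - b*e^2 - c*d^2),
       (a*b - d^2) + (a*c - e^2) + (b*c - f^2), -(a + b + c), 1:]
      = [:-t1, 1:] * [:-t2, 1:] * [:-t3, 1:]"
proof -
  define p where "p = [:-(a*b*c + 2*d*e*f - a*f^2 - b*e^2 - c*d^2),
       (a*b - d^2) + (a*c - e^2) + (b*c - f^2), -(a + b + c), 1:]"
  have p: "poly p t = (t - a) * ((t - b) * (t - c) - f^2) - (t - b) * e^2 - (t - c) * d^2 - 2*d*e*f" for t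
    by (simp add: p_def algebra_simps power2_eq_square)
  define s where "s = sqrt ((b - c)^2 + 4 * f^2)"
  have s2: "s^2 = (b - c)^2 + 4 * f^2"
    by (simp add: s_def)
  have "\<bar>b - c\<bar> < s"
    unfolding s_def using pos by (intro real_less_rsqrt) auto
  define \<alpha> \<beta> where "\<alpha> = (b + c - s) / 2" and "\<beta> = (b + c + s) / 2"
  have \<alpha>: "\<alpha> < b" "\<alpha> < c" and \<beta>: "b < \<beta>" "c < \<beta>"
    using \<open>\<bar>b - c\<bar> < s\<close> by (auto simp: \<alpha>_def \<beta>_def)
  have \<alpha>_root: "(\<alpha> - b) * (\<alpha> - c) = f^2" and \<beta>_root: "(\<beta> - b) * (\<beta> - c) = f^2"
    using s2 by (simp_all add: \<alpha>_def \<beta>_def field_simps power2_eq_square)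
  have "poly p \<beta> < 0"
  proof -
    have "0 < (\<beta> - b) * e^2" "0 < (\<beta> - c) * d^2" "0 < d * e * f"
      using pos \<beta> by auto
    then show ?thesis
      unfolding p \<beta>_root by simp
  qed
  have "0 \<le> poly p \<alpha>"
  proof -
    \<comment> \<open>With \<open>(b - \<alpha>)(c - \<alpha>) = f\<^sup>2\<close> this is the inequality of arithmetic and geometric means.\<close>
    have "(2*d*e*f)^2 \<le> ((b - \<alpha>) * e^2 + (c - \<alpha>) * d^2)^2"
    proof -
      have "((b - \<alpha>) * e^2 + (c - \<alpha>) * d^2)^2 - (2*d*e*f)^2 = ((b - \<alpha>) * e^2 - (c - \<alpha>) * d^2)^2"
        using \<alpha>_root by algebra
      then show ?thesis
        by (metis diff_ge_0_iff_ge zero_le_power2)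
    qed
    then have "2*d*e*f \<le> (b - \<alpha>) * e^2 + (c - \<alpha>) * d^2"
      by (rule power2_le_imp_le) (use \<alpha> in auto)
    then show ?thesis
      unfolding p \<alpha>_root by (simp add: algebra_simps)
  qed
  obtain t1 where t1: "\<beta> < t1" "poly p t1 = 0"
  proof -
    have "0 < lead_coeff p"
      by (simp add: p_def)
    then obtain n where n: "\<And>x. x \<ge> n \<Longrightarrow> lead_coeff p \<le> poly p x"
      using poly_pinfty_gt_lc by blast
    then have "0 < poly p (max n (\<beta> + 1))"
      using \<open>0 < lead_coeff p\<close> by (meson less_le_trans max.cobounded1)
    moreover have "\<beta> < max n (\<beta> + 1)"
      by (simp add: less_max_iff_disj)
    ultimately show ?thesis
      using poly_IVT_pos[of \<beta> "max n (\<beta> + 1)" p] \<open>poly p \<beta> < 0\<close> that by blast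
  qed
  define B where "B = t1 - (a + b + c)"
  define C where "C = (a*b - d^2) + (a*c - e^2) + (b*c - f^2) + t1 * B"
  have quot: "p = [:-t1, 1:] * [:C, B, 1:]"
    using t1(2) by (simp add: p_def B_def C_def algebra_simps power2_eq_square)
  have "\<alpha>^2 + B * \<alpha> + C \<le> 0"
  proof -
    have "0 \<le> (\<alpha> - t1) * (\<alpha>^2 + B * \<alpha> + C)"
      using \<open>0 \<le> poly p \<alpha>\<close> unfolding quot by (simp add: algebra_simps power2_eq_square)
    moreover have "\<alpha> - t1 < 0"
      using t1 \<alpha> \<beta> by simp
    ultimately show ?thesis
      by (simp add: zero_le_mult_iff)
  qed
  moreover have "4 * (\<alpha>^2 + B * \<alpha> + C) = (2 * \<alpha> + B)^2 - (B^2 - 4 * C)"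
    by (simp add: algebra_simps power2_eq_square)
  ultimately have "0 \<le> B^2 - 4 * C"
    by (smt (verit) zero_le_power2)
  define r where "r = sqrt (B^2 - 4 * C)"
  have "r^2 = B^2 - 4 * C"
    using \<open>0 \<le> B^2 - 4 * C\<close> by (simp add: r_def)
  then have "((- B + r) / 2) * ((- B - r) / 2) = C"
    by (simp add: field_simps power2_eq_square)
  moreover have "- ((- B + r) / 2 + (- B - r) / 2) = B"
    by (simp add: field_simps)
  moreover have "[:-x, 1:] * [:-y, 1:] = [:x * y, - (x + y), 1:]" for x y :: real
    by simp
  ultimately have "[:-((- B + r) / 2), 1:] * [:-((- B - r) / 2), 1:] = [:C, B, 1:]"
    by (simp only:)
  then have "p = [:-t1, 1:] * [:-((- B + r) / 2), 1:] * [:-((- B - r) / 2), 1:]"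
    unfolding quot by (simp only: mult.assoc)
  then show ?thesis
    unfolding p_def by (rule that[rotated]) (use t1 \<beta> pos in linarith)
qed

text \<open>
  With positive trace and one positive root, the signs of the other two roots can be read off from
  the second and third elementary symmetric functions. If, say, \<open>t2 > 0\<close>, then a nonnegative product
  forces \<open>t3 \<ge> 0\<close>, and the second symmetric function is positive. Conversely, for
  \<open>t2, t3 \<le> 0\<close> it is at most \<open>(t1 + t2 + t3)(t2 + t3) \<le> 0\<close>.
\<close>

lemma nonpos_roots_iff_3:
  fixes t1 t2 t3 :: real
  assumes "0 < t1" "0 < t1 + t2 + t3"
  shows "t2 \<le> 0 \<and> t3 \<le> 0 \<longleftrightarrow> t1 * t2 + t1 * t3 + t2 * t3 \<le> 0 \<and> 0 \<le> t1 * t2 * t3"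
proof
  assume neg: "t2 \<le> 0 \<and> t3 \<le> 0"
  have "(t1 + t2 + t3) * (t2 + t3) \<le> 0"
    using assms neg by (intro mult_nonneg_nonpos) auto
  moreover have "0 \<le> t2 * t2" "0 \<le> t3 * t3" "0 \<le> t2 * t3"
    using neg by (auto intro: mult_nonpos_nonpos)
  ultimately have "t1 * t2 + t1 * t3 + t2 * t3 \<le> 0"
    unfolding distrib_left distrib_right mult.commute[of t3 t2] by linarith
  moreover have "0 \<le> t1 * (t2 * t3)"
    using assms neg by (simp add: mult_nonpos_nonpos)
  ultimately show "t1 * t2 + t1 * t3 + t2 * t3 \<le> 0 \<and> 0 \<le> t1 * t2 * t3"
    by (simp add: mult.assoc)
next
  assume *: "t1 * t2 + t1 * t3 + t2 * t3 \<le> 0 \<and> 0 \<le> t1 * t2 * t3"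
  have no_pos: False if "0 < x" "0 \<le> t1 * x * y" "t1 * x + t1 * y + x * y \<le> 0" for x y
  proof -
    have "0 < t1 * x"
      using that assms by simp
    moreover from this have "0 \<le> y"
      using that(2) mult_pos_neg[of "t1 * x" y] by linarith
    moreover from this have "0 \<le> t1 * y" "0 \<le> x * y"
      using that assms by auto
    ultimately show False
      using that by linarith
  qed
  show "t2 \<le> 0 \<and> t3 \<le> 0"
    using no_pos[of t2 t3] no_pos[of t3 t2] * by (force simp: algebra_simps)
qed

text \<open>
  With nonnegative determinant and positive diagonal, no two principal minors of order two have
  strictly opposite signs, because
  \<open>x \<cdot> det = (xy - l\<^sup>2)(xz - m\<^sup>2) - (xn - lm)\<^sup>2\<close> for the symmetric matrix with
  diagonal \<open>x, y, z\<close> and off-diagonal entries \<open>l, m, n\<close>. So the sign of their sum decides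
  all of them.
\<close>

lemma principal_minors_nonpos_iff_3:
  fixes a b c d e f :: real
  assumes pos: "a > 0" "b > 0" "c > 0"
    and det: "0 \<le> a*b*c + 2*d*e*f - a*f^2 - b*e^2 - c*d^2"
  shows "(a*b - d^2) + (a*c - e^2) + (b*c - f^2) \<le> 0 \<longleftrightarrow>
    a*b \<le> d^2 \<and> a*c \<le> e^2 \<and> b*c \<le> f^2" (is "?s \<le> 0 \<longleftrightarrow> ?r")
proof
  assume s: "?s \<le> 0"
  have id: "x * (x*y*z + 2*l*m*n - x*n^2 - y*m^2 - z*l^2) = (x*y - l^2) * (x*z - m^2) - (x*n - l*m)^2"
    for x y z l m n :: real
    by (simp add: algebra_simps power2_eq_square)
  have id': "0 \<le> (x*y - l^2) * (x*z - m^2)"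
    if "0 < x" "0 \<le> x*y*z + 2*l*m*n - x*n^2 - y*m^2 - z*l^2" for x y z l m n :: real
  proof -
    have "0 \<le> x * (x*y*z + 2*l*m*n - x*n^2 - y*m^2 - z*l^2)"
      using that by simp
    then show ?thesis
      unfolding id by (smt (verit) zero_le_power2)
  qed
  have "0 \<le> (a*b - d^2) * (a*c - e^2)" "0 \<le> (b*a - d^2) * (b*c - f^2)" "0 \<le> (c*a - e^2) * (c*b - f^2)"
    by (intro id'[of a b c d e f] id'[of b a c d f e] id'[of c a b e f d] pos; use det in \<open>simp add: algebra_simps\<close>)+
  then show ?r
    using s by (auto simp: zero_le_mult_iff mult.commute)
qed auto

definition log_ratios :: "real^3^3 \<Rightarrow> real \<times> real \<times> real" where
  "log_ratios P = (ln (PX P), ln (PY P), ln (PZ P))"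

lemma at_most_one_pos_eigenvalue_iff_principal_minors:
  fixes P :: "real^3^3"
  assumes sym: "transpose P = P" and pos: "\<And>i j. P $ i $ j > 0"
  defines "a \<equiv> P $ 1 $ 1" and "b \<equiv> P $ 2 $ 2" and "c \<equiv> P $ 3 $ 3"
    and "d \<equiv> P $ 1 $ 2" and "e \<equiv> P $ 1 $ 3" and "f \<equiv> P $ 2 $ 3"
  shows "at_most_one_pos_eigenvalue P \<longleftrightarrow>
    a*b \<le> d^2 \<and> a*c \<le> e^2 \<and> b*c \<le> f^2 \<and> 0 \<le> a*b*c + 2*d*e*f - a*f^2 - b*e^2 - c*d^2"
proof -
  have pos': "a > 0" "b > 0" "c > 0" "d > 0" "e > 0" "f > 0"
    using pos by (auto simp: a_def b_def c_def d_def e_def f_def)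
  note cp = charpoly_3[OF sym, folded a_def b_def c_def d_def e_def f_def]
  obtain t1 t2 t3 where "t1 > 0" and fac: "charpoly P = [:-t1, 1:] * [:-t2, 1:] * [:-t3, 1:]"
    using interlacing_roots_3[OF pos'(2-6), of a] unfolding cp by metis
  have vieta: "a*b*c + 2*d*e*f - a*f^2 - b*e^2 - c*d^2 = t1 * t2 * t3"
    "(a*b - d^2) + (a*c - e^2) + (b*c - f^2) = t1 * t2 + t1 * t3 + t2 * t3"
    "a + b + c = t1 + t2 + t3"
    using fac unfolding cp by (auto simp: algebra_simps)
  have proots_mult3: "proots (p * q * r) = proots p + proots q + proots r"
    if "p \<noteq> 0" "q \<noteq> 0" "r \<noteq> 0" for p q r :: "real poly"
    using that proots_mult[of "p * q" r] proots_mult[of p q] by simp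
  have "proots (charpoly P) = proots [:-t1, 1:] + proots [:-t2, 1:] + proots [:-t3, 1:]"
    unfolding fac by (rule proots_mult3; simp)
  then have "at_most_one_pos_eigenvalue P \<longleftrightarrow> t2 \<le> 0 \<and> t3 \<le> 0"
    using \<open>t1 > 0\<close> by (simp add: at_most_one_pos_eigenvalue_def not_less)
  also have "\<dots> \<longleftrightarrow> t1 * t2 + t1 * t3 + t2 * t3 \<le> 0 \<and> 0 \<le> t1 * t2 * t3"
    using \<open>t1 > 0\<close> pos' vieta by (intro nonpos_roots_iff_3) auto
  also have "\<dots> \<longleftrightarrow> a*b \<le> d^2 \<and> a*c \<le> e^2 \<and> b*c \<le> f^2 \<and> 0 \<le> a*b*c + 2*d*e*f - a*f^2 - b*e^2 - c*d^2"
    using principal_minors_nonpos_iff_3[OF pos'(1-3), of d e f] unfolding vieta by auto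
  finally show ?thesis .
qed

lemma at_most_one_pos_eigenvalue_iff_log_ratios:
  fixes P :: "real^3^3"
  assumes sym: "transpose P = P" and pos: "\<And>i j. P $ i $ j > 0"
  shows "at_most_one_pos_eigenvalue P \<longleftrightarrow> log_ratios P \<in> log_region"
proof -
  define a b c d e f where "a = P $ 1 $ 1" and "b = P $ 2 $ 2" and "c = P $ 3 $ 3"
    and "d = P $ 1 $ 2" and "e = P $ 1 $ 3" and "f = P $ 2 $ 3"
  note abc = a_def b_def c_def d_def e_def f_def
  have pos': "a > 0" "b > 0" "c > 0" "d > 0" "e > 0" "f > 0"
    using pos by (auto simp: abc)
  define x y z where "x = a * f / (d * e)" and "y = b * e / (d * f)" and "z = c * d / (e * f)"
  have xyz: "x > 0" "y > 0" "z > 0"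
    using pos' by (auto simp: x_def y_def z_def)
  have "log_ratios P \<in> log_region \<longleftrightarrow> x * y \<le> 1 \<and> x * z \<le> 1 \<and> y * z \<le> 1 \<and> x + y + z \<le> x * y * z + 2"
  proof -
    have "log_ratios P = (ln x, ln y, ln z)"
      by (simp add: log_ratios_def PX_def PY_def PZ_def x_def y_def z_def abc)
    moreover have "ln u + ln v \<le> 0 \<longleftrightarrow> u * v \<le> 1" if "u > 0" "v > 0" for u v :: real
      using that by (simp flip: ln_mult_pos)
    ultimately show ?thesis
      using xyz by (simp add: log_region_def exp_add)
  qed
  also have "\<dots> \<longleftrightarrow> a*b \<le> d^2 \<and> a*c \<le> e^2 \<and> b*c \<le> f^2 \<and>
      0 \<le> a*b*c + 2*d*e*f - a*f^2 - b*e^2 - c*d^2"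
  proof -
    have "x * y \<le> 1 \<longleftrightarrow> a * b \<le> d^2" "x * z \<le> 1 \<longleftrightarrow> a * c \<le> e^2" "y * z \<le> 1 \<longleftrightarrow> b * c \<le> f^2"
      using pos' by (simp_all add: x_def y_def z_def power2_eq_square divide_le_eq)
    moreover have "x * y * z + 2 - (x + y + z) =
        (a*b*c + 2*d*e*f - a*f^2 - b*e^2 - c*d^2) / (d * e * f)"
      using pos' by (simp add: x_def y_def z_def field_simps power2_eq_square)
    then have "x + y + z \<le> x * y * z + 2 \<longleftrightarrow>
        0 \<le> (a*b*c + 2*d*e*f - a*f^2 - b*e^2 - c*d^2) / (d * e * f)"
      by linarith
    moreover have "0 \<le> r / (d * e * f) \<longleftrightarrow> 0 \<le> r" for r
      using pos' by (simp add: zero_le_divide_iff mult_le_0_iff not_le)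
    ultimately show ?thesis
      by (simp only:)
  qed
  finally show ?thesis
    using at_most_one_pos_eigenvalue_iff_principal_minors[OF assms, folded abc] by (simp only:)
qed

text \<open>
  A point is realized by the matrix with off-diagonal entries 1: scaling rows and columns by a
  positive diagonal matrix leaves the three ratios unchanged and can normalize the off-diagonal
  entries in this way.
\<close>

lemma log_ratios_image: "log_ratios ` pos_sym_matrices = log_region"
proof
  show "log_ratios ` pos_sym_matrices \<subseteq> log_region"
    using at_most_one_pos_eigenvalue_iff_log_ratios by (auto simp: pos_sym_matrices_def)
next
  show "log_region \<subseteq> log_ratios ` pos_sym_matrices"
  proof
    fix U assume U: "U \<in> log_region"
    obtain u v w where uvw: "U = (u, v, w)"
      by (cases U)
    define P :: "real^3^3" where
      "P = vector [vector [exp u, 1, 1], vector [1, exp v, 1], vector [1, 1, exp w]]"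
    have "\<forall>i j. P $ i $ j = P $ j $ i \<and> P $ i $ j > 0"
      by (simp add: forall_3 P_def)
    then have P: "transpose P = P" "\<And>i j. P $ i $ j > 0"
      by (auto simp: transpose_def vec_eq_iff)
    moreover have "log_ratios P = U"
      by (simp add: log_ratios_def PX_def PY_def PZ_def P_def uvw)
    ultimately show "U \<in> log_ratios ` pos_sym_matrices"
      using U at_most_one_pos_eigenvalue_iff_log_ratios[OF P]
      by (force simp: pos_sym_matrices_def)
  qed
qed


section \<open>Convexity of the region of logarithmic ratios\<close>

text \<open>
  The condition \<open>e\<^sup>u + e\<^sup>v + e\<^sup>w \<le> e\<^bsup>u+v+w\<^esup> + 2\<close> solved for \<open>w\<close>. Both logarithms have positive
  arguments when \<open>e\<^sup>u + e\<^sup>v < 2\<close>, since then \<open>e\<^bsup>u+v\<^esup> < 1\<close>.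
\<close>

definition roof :: "real \<Rightarrow> real \<Rightarrow> real" where
  "roof u v = ln (2 - exp u - exp v) - ln (1 - exp (u + v))"

text \<open>
  This is \<^const>\<open>log_region\<close> without the ray \<open>u = v = 0\<close>, \<open>w \<le> 0\<close>, over which the region is not
  below the graph of a function.
\<close>

definition log_region_body :: "(real \<times> real \<times> real) set" where
  "log_region_body = {(u, v, w). exp u + exp v < 2 \<and> w \<le> roof u v}"

lemma mult_less_one_if_sum_less_two:
  fixes x y :: real
  assumes "0 < x" "0 < y" "x + y < 2"
  shows "x * y < 1"
proof -
  have "4 * (x * y) = (x + y)^2 - (x - y)^2"
    by (simp add: power2_eq_square algebra_simps)
  also have "\<dots> \<le> (x + y)^2"
    by simp
  also have "\<dots> < 2^2"
    using assms by (intro power_strict_mono) auto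
  finally show ?thesis
    by simp
qed

text \<open>
  Divided by \<open>D\<^sup>2 E\<^sup>2\<close>, the left side minus the right side is the second derivative of \<^const>\<open>roof\<close> in
  direction \<open>(p, q)\<close>, with \<open>x = e\<^sup>u\<close> and \<open>y = e\<^sup>v\<close>. Let \<open>N\<close> be the factor of \<open>E\<^sup>2\<close> on the right and
  \<open>W = x(1 - y) + y(1 - x)\<close>. Then
  \<open>W N = D (p + q)\<^sup>2 xy + 2 (x(1 - y)p - y(1 - x)q)\<^sup>2\<close>, and \<open>D + W = 2E\<close> gives \<open>D W \<le> E\<^sup>2\<close>. Together
  \<open>D\<^sup>2 (p + q)\<^sup>2 xy \<le> D W N \<le> E\<^sup>2 N\<close>.
\<close>

lemma roof_second_derivative_bound:
  fixes x y p q :: real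
  assumes x: "0 < x" and y: "0 < y" and xy: "x + y < 2"
  defines "D \<equiv> 2 - x - y" and "E \<equiv> 1 - x * y"
  shows "(p + q)^2 * (x * y) * D^2 \<le> ((p^2 * x + q^2 * y) * D + (p * x + q * y)^2) * E^2"
proof -
  define N where "N = (p^2 * x + q^2 * y) * D + (p * x + q * y)^2"
  define W where "W = x * (1 - y) + y * (1 - x)"
  have D: "0 < D" and E: "0 < E"
    using assms mult_less_one_if_sum_less_two[OF x y xy] by auto
  have DW: "D + W = 2 * E"
    by (simp add: D_def E_def W_def algebra_simps)
  have "0 < W"
  proof -
    have "2 * (x * y) < x + y"
    proof -
      have "4 * (x * y) \<le> (x + y) * (x + y)"
        using zero_le_power2[of "x - y"] by (simp add: power2_eq_square algebra_simps)
      also have "\<dots> < (x + y) * 2"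
        using assms by (intro mult_strict_left_mono) auto
      finally show ?thesis
        by simp
    qed
    then show ?thesis
      by (simp add: W_def algebra_simps)
  qed
  have "W * N = D * ((p + q)^2 * (x * y)) + 2 * (x * (1 - y) * p - y * (1 - x) * q)^2"
    unfolding W_def N_def D_def by algebra
  then have WN: "D * ((p + q)^2 * (x * y)) \<le> W * N"
    by simp
  have "0 \<le> N"
    using x y D by (simp add: N_def)
  have "D * W \<le> E^2"
  proof -
    have "4 * (D * W) = (D + W)^2 - (D - W)^2"
      by (simp add: power2_eq_square algebra_simps)
    also have "\<dots> \<le> 4 * E^2"
      unfolding DW by (simp add: power2_eq_square)
    finally show ?thesis
      by simp
  qed
  have "(p + q)^2 * (x * y) * D^2 = D * (D * ((p + q)^2 * (x * y)))"
    by (simp add: power2_eq_square algebra_simps)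
  also have "\<dots> \<le> D * (W * N)"
    using WN D by (intro mult_left_mono) auto
  also have "\<dots> \<le> N * E^2"
    using mult_right_mono[OF \<open>D * W \<le> E^2\<close> \<open>0 \<le> N\<close>] by (simp add: mult_ac)
  finally show ?thesis
    by (simp add: N_def)
qed

lemma exp_affine_convex:
  fixes u v t :: real
  assumes "0 \<le> t" "t \<le> 1"
  shows "exp ((1 - t) * u + t * v) \<le> (1 - t) * exp u + t * exp v"
  using convex_onD[OF exp_convex assms, of u v] by simp

lemma roof_concave_segment:
  assumes P: "exp u + exp v < 2" and Q: "exp u' + exp v' < 2" and t: "0 \<le> t" "t \<le> 1"
  defines "ut \<equiv> (1 - t) * u + t * u'" and "vt \<equiv> (1 - t) * v + t * v'"
  shows "exp ut + exp vt < 2"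
    and "(1 - t) * roof u v + t * roof u' v' \<le> roof ut vt"
proof -
  define p q where "p = u' - u" and "q = v' - v"
  define x y where "x = (\<lambda>s. exp (u + s * p))" and "y = (\<lambda>s. exp (v + s * q))"
  have pos: "0 < x s" "0 < y s" for s
    by (auto simp: x_def y_def)
  have below: "x s + y s < 2" if "s \<in> {0..1}" for s
  proof -
    have "x s + y s \<le> (1 - s) * (exp u + exp v) + s * (exp u' + exp v')"
      using exp_affine_convex[of s u u'] exp_affine_convex[of s v v'] that
      by (simp add: x_def y_def p_def q_def algebra_simps)
    also have "\<dots> < 2"
    proof (rule ccontr)
      assume "\<not> ?thesis"
      moreover have "(1 - s) * (exp u + exp v) \<le> (1 - s) * max (exp u + exp v) (exp u' + exp v')"
        "s * (exp u' + exp v') \<le> s * max (exp u + exp v) (exp u' + exp v')"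
        using that by (auto intro!: mult_left_mono)
      ultimately have "2 \<le> max (exp u + exp v) (exp u' + exp v')"
        by (simp add: algebra_simps)
      then show False
        using P Q by simp
    qed
    finally show ?thesis .
  qed
  define D E where "D = (\<lambda>s. 2 - x s - y s)" and "E = (\<lambda>s. 1 - x s * y s)"
  have DE: "0 < D s" "0 < E s" if "s \<in> {0..1}" for s
    using below[OF that] pos mult_less_one_if_sum_less_two[of "x s" "y s"] by (auto simp: D_def E_def)
  have dx: "(x has_real_derivative p * x s) (at s)" and dy: "(y has_real_derivative q * y s) (at s)" for s
    unfolding x_def y_def by (auto intro!: derivative_eq_intros)
  have "concave_on {0..1} (\<lambda>s. ln (D s) - ln (E s))"
  proof (rule f''_le0_imp_concave)
    fix s :: real assume s: "s \<in> {0..1}"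
    show "((\<lambda>s. ln (D s) - ln (E s)) has_real_derivative
        - (p * x s + q * y s) / D s + (p + q) * (x s * y s) / E s) (at s)"
      using DE[OF s] unfolding D_def E_def
      by (auto intro!: derivative_eq_intros dx dy simp: field_simps)
    show "((\<lambda>s. - (p * x s + q * y s) / D s + (p + q) * (x s * y s) / E s) has_real_derivative
        (p + q)^2 * (x s * y s) / (E s)^2
          - ((p^2 * x s + q^2 * y s) * D s + (p * x s + q * y s)^2) / (D s)^2) (at s)"
    proof -
      have dD: "(D has_real_derivative - (p * x s + q * y s)) (at s)"
        and dE: "(E has_real_derivative - ((p + q) * (x s * y s))) (at s)"
        unfolding D_def E_def
        by (auto intro!: derivative_eq_intros dx dy simp: algebra_simps)
      have 1: "((\<lambda>s. - (p * x s + q * y s)) has_real_derivative - (p^2 * x s + q^2 * y s)) (at s)"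
        and 2: "((\<lambda>s. (p + q) * (x s * y s)) has_real_derivative (p + q)^2 * (x s * y s)) (at s)"
        by (auto intro!: derivative_eq_intros dx dy simp: algebra_simps power2_eq_square)
      have e1: "(p + q)^2 * (x s * y s) / (E s)^2 =
          ((p + q)^2 * (x s * y s) * E s - (p + q) * (x s * y s) * - ((p + q) * (x s * y s))) / (E s * E s)"
        by (simp add: E_def power2_eq_square algebra_simps)
      have e2: "- ((p^2 * x s + q^2 * y s) * D s + (p * x s + q * y s)^2) / (D s)^2 =
          (- (p^2 * x s + q^2 * y s) * D s - - (p * x s + q * y s) * - (p * x s + q * y s)) / (D s * D s)"
        by (simp add: power2_eq_square algebra_simps)
      have "D s \<noteq> 0" "E s \<noteq> 0"
        using DE[OF s] by auto
      from DERIV_add[OF DERIV_divide[OF 1 dD this(1)] DERIV_divide[OF 2 dE this(2)]]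
      show ?thesis
        unfolding e1[symmetric] e2[symmetric] by (rule DERIV_cong) (simp add: diff_divide_distrib add_divide_distrib)
    qed
    show "(p + q)^2 * (x s * y s) / (E s)^2
          - ((p^2 * x s + q^2 * y s) * D s + (p * x s + q * y s)^2) / (D s)^2 \<le> 0"
    proof -
      have "(p + q)^2 * (x s * y s) * (D s)^2 \<le> ((p^2 * x s + q^2 * y s) * D s + (p * x s + q * y s)^2) * (E s)^2"
        using roof_second_derivative_bound[OF pos below[OF s], of p q] by (simp only: D_def E_def)
      then have "(p + q)^2 * (x s * y s) / (E s)^2
          \<le> ((p^2 * x s + q^2 * y s) * D s + (p * x s + q * y s)^2) / (D s)^2"
        using DE[OF s] by (simp only: pos_divide_le_eq pos_le_divide_eq times_divide_eq_left zero_less_power)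
      then show ?thesis
        by simp
    qed
  qed simp
  then have "(1 - t) * (ln (D 0) - ln (E 0)) + t * (ln (D 1) - ln (E 1)) \<le> ln (D t) - ln (E t)"
    using concave_onD[of "{0..1}" "\<lambda>s. ln (D s) - ln (E s)" t 0 1] t by simp
  moreover have ends: "x 0 = exp u" "y 0 = exp v" "x 1 = exp u'" "y 1 = exp v'" "x t = exp ut" "y t = exp vt"
    by (simp_all add: x_def y_def p_def q_def ut_def vt_def algebra_simps)
  ultimately show "(1 - t) * roof u v + t * roof u' v' \<le> roof ut vt"
    by (simp add: roof_def D_def E_def exp_add)
  show "exp ut + exp vt < 2"
    using below[of t] t by (simp add: ends)
qed

lemma convex_log_region_body: "convex log_region_body"
  unfolding convex_alt
proof (intro ballI allI impI)
  fix X Y and t :: real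
  assume X: "X \<in> log_region_body" and Y: "Y \<in> log_region_body" and t: "0 \<le> t \<and> t \<le> 1"
  obtain u v w u' v' w' where XY: "X = (u, v, w)" "Y = (u', v', w')"
    by (metis prod_cases3)
  have "(1 - t) * w + t * w' \<le> (1 - t) * roof u v + t * roof u' v'"
    using X Y t by (intro add_mono mult_left_mono) (auto simp: XY log_region_body_def)
  then show "(1 - t) *\<^sub>R X + t *\<^sub>R Y \<in> log_region_body"
    using roof_concave_segment[of u v u' v' t] X Y t
    by (auto simp: XY log_region_body_def)
qed

lemma le_roof_iff:
  assumes "exp u + exp v < 2"
  shows "w \<le> roof u v \<longleftrightarrow> exp u + exp v + exp w \<le> exp (u + v + w) + 2"
proof -
  have E: "exp (u + v) < 1"
    using mult_less_one_if_sum_less_two[of "exp u" "exp v"] assms by (simp add: exp_add)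
  have "w \<le> roof u v \<longleftrightarrow> exp w \<le> exp (roof u v)"
    by simp
  also have "exp (roof u v) = (2 - exp u - exp v) / (1 - exp (u + v))"
    using assms E by (simp add: roof_def exp_diff)
  also have "exp w \<le> \<dots> \<longleftrightarrow> exp u + exp v + exp w \<le> exp (u + v + w) + 2"
    using E by (simp add: pos_le_divide_eq algebra_simps exp_add)
  finally show ?thesis .
qed

lemma log_region_body_subset: "log_region_body \<subseteq> log_region"
proof
  fix X assume "X \<in> log_region_body"
  then obtain u v w where X: "X = (u, v, w)" and uv: "exp u + exp v < 2" and w: "w \<le> roof u v"
    by (auto simp: log_region_body_def)
  define x y z where "x = exp u" and "y = exp v" and "z = exp w"
  have pos: "0 < x" "0 < y" "0 < z" and xy: "x + y < 2"
    using uv by (auto simp: x_def y_def z_def)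
  have "x * y < 1"
    using pos xy by (intro mult_less_one_if_sum_less_two)
  have det: "x + y + z \<le> x * y * z + 2"
    using w le_roof_iff[OF uv] by (simp add: x_def y_def z_def exp_add)
  have bound: "r * z \<le> 1" if "0 < r" "0 < s" "r * s < 1" "r + s + z \<le> r * s * z + 2" for r s
  proof -
    have "(r * z) * (1 - r * s) = r * (z - r * s * z)"
      by (simp add: algebra_simps)
    also have "\<dots> \<le> r * (2 - r - s)"
      using that by (intro mult_left_mono) auto
    also have "\<dots> = (1 - r * s) - (1 - r)^2"
      by (simp add: algebra_simps power2_eq_square)
    also have "\<dots> \<le> 1 * (1 - r * s)"
      by simp
    finally show ?thesis
      using that by (simp only: mult_le_cancel_right)
  qed
  have "x * z \<le> 1" "y * z \<le> 1"
    using bound[of x y] bound[of y x] pos \<open>x * y < 1\<close> det by (simp_all add: mult.commute)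
  moreover have "exp r * exp s \<le> 1 \<longleftrightarrow> r + s \<le> 0" for r s :: real
    by (simp flip: exp_add)
  ultimately show "X \<in> log_region"
    using less_imp_le[OF \<open>x * y < 1\<close>] det by (simp add: X log_region_def x_def y_def z_def exp_add)
qed

lemma closed_log_region: "closed log_region"
proof -
  have "log_region = {X. fst X + fst (snd X) \<le> 0} \<inter> {X. fst X + snd (snd X) \<le> 0} \<inter>
      {X. fst (snd X) + snd (snd X) \<le> 0} \<inter>
      {X. exp (fst X) + exp (fst (snd X)) + exp (snd (snd X))
          \<le> exp (fst X + fst (snd X) + snd (snd X)) + 2}"
    by (auto simp: log_region_def)
  also have "closed \<dots>"
    by (intro closed_Int closed_Collect_le continuous_intros)
  finally show ?thesis .
qed

text \<open>
  Off the ray \<open>u = v = 0\<close> the two sets agree: if \<open>u + v < 0\<close>, the determinant condition forces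
  \<open>e\<^sup>u + e\<^sup>v < 2\<close>, and if \<open>u + v = 0\<close>, it forces \<open>e\<^sup>u + e\<^sup>v \<le> 2\<close>, hence \<open>u = v = 0\<close>. A point
  \<open>(0, 0, w)\<close> of the ray is the limit of the points \<open>(-1/n, -1/n, w)\<close>.
\<close>

lemma log_region_eq_closure: "log_region = closure log_region_body"
proof
  show "closure log_region_body \<subseteq> log_region"
    using log_region_body_subset closed_log_region by (rule closure_minimal)
  show "log_region \<subseteq> closure log_region_body"
  proof
    fix X assume "X \<in> log_region"
    then obtain u v w where X: "X = (u, v, w)" and uv: "u + v \<le> 0" and uw: "u + w \<le> 0"
      and det: "exp u + exp v + exp w \<le> exp (u + v + w) + 2"
      by (auto simp: log_region_def)
    show "X \<in> closure log_region_body"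
    proof (cases "u + v = 0")
      case False
      then have "0 < exp w * (1 - exp (u + v))"
        using uv by (auto simp: exp_less_one_iff)
      also have "\<dots> \<le> 2 - exp u - exp v"
        using det by (simp add: algebra_simps exp_add)
      finally have "exp u + exp v < 2"
        by simp
      then have "X \<in> log_region_body"
        using det le_roof_iff[of u v w] by (simp add: X log_region_body_def)
      then show ?thesis
        using closure_subset by blast
    next
      case True
      then have "exp u * exp v = 1"
        by (simp flip: exp_add)
      then have "(exp u - 1)^2 = exp u * (exp u + exp v - 2)"
        by (simp add: power2_eq_square algebra_simps)
      also have "\<dots> \<le> 0"
        using det True by (intro mult_nonneg_nonpos) auto
      finally have "u = 0"
        by simp
      then have 0: "X = (0, 0, w)" "w \<le> 0"
        using True uw by (auto simp: X)
      define Y :: "nat \<Rightarrow> real \<times> real \<times> real"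
        where "Y n = (- inverse (Suc n), - inverse (Suc n), w)" for n
      have "Y n \<in> log_region_body" for n
      proof -
        define a r where "a = - inverse (real (Suc n))" and "r = exp a"
        have r: "0 < r" "r < 1"
          unfolding r_def a_def by auto
        have "exp w * (1 - r * r) \<le> 1 * (1 - r * r)"
          using r 0 by (intro mult_right_mono) (auto simp: mult_le_one)
        also have "\<dots> = (2 - r - r) - (1 - r)^2"
          by (simp add: power2_eq_square algebra_simps)
        also have "\<dots> \<le> 2 - r - r"
          by simp
        finally have "r + r + exp w \<le> r * r * exp w + 2"
          by (simp add: algebra_simps)
        then have "exp a + exp a + exp w \<le> exp (a + a + w) + 2"
          by (simp only: exp_add r_def)
        moreover have "exp a + exp a < 2"
          using r by (simp add: r_def)
        ultimately have "(a, a, w) \<in> log_region_body"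
          using le_roof_iff[of a a w] by (simp add: log_region_body_def)
        then show ?thesis
          by (simp add: Y_def a_def)
      qed
      moreover have "Y \<longlonglongrightarrow> (- 0, - 0, w)"
        unfolding Y_def by (intro tendsto_intros LIMSEQ_inverse_real_of_nat)
      ultimately show ?thesis
        unfolding closure_sequential 0(1) by auto
    qed
  qed
qed

lemma convex_log_region: "convex log_region"
  unfolding log_region_eq_closure by (intro convex_closure convex_log_region_body)


section \<open>Cubics as triples of matrices\<close>

definition slice :: "poly3 \<Rightarrow> 3 \<Rightarrow> real^3^3" where
  "slice f i = (\<chi> j k. ncoeff f (ee i + ee j + ee k))"

definition log_Rs :: "poly3 \<Rightarrow> (real \<times> real \<times> real) \<times> (real \<times> real \<times> real) \<times> (real \<times> real \<times> real)" where
  "log_Rs f = (log_ratios (slice f 1), log_ratios (slice f 2), log_ratios (slice f 3))"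

text \<open>
  The logarithms of \<open>R\<^sub>1\<^sub>3 R\<^sub>3\<^sub>1 / (R\<^sub>2\<^sub>1 R\<^sub>2\<^sub>3)\<close> and \<open>R\<^sub>3\<^sub>2 R\<^sub>2\<^sub>3 / (R\<^sub>1\<^sub>2 R\<^sub>1\<^sub>3)\<close>, where the triples hold the
  logarithms of the ratios of the first, second and third slice.
\<close>

definition gluing_defect ::
    "(real \<times> real \<times> real) \<times> (real \<times> real \<times> real) \<times> (real \<times> real \<times> real) \<Rightarrow> real \<times> real" where
  "gluing_defect = (\<lambda>((a1, a2, a3), (b1, b2, b3), (c1, c2, c3)). (a3 + c1 - b1 - b3, c2 + b3 - a2 - a3))"

lemma linear_gluing_defect: "linear gluing_defect"
  by (rule linearI) (auto simp: gluing_defect_def algebra_simps split: prod.splits)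

lemma ee_nth: "ee i $ j = (if i = j then 1 else 0)"
  by (simp add: ee_def axis_def)

lemma ee_sum_in_Delta33: "ee i + ee j + ee k \<in> Delta33"
proof -
  have "(\<Sum>m\<in>UNIV. ee i $ m) = 1" for i
    by (simp add: ee_nth)
  then have "ee i $ 1 + ee i $ 2 + ee i $ 3 = 1" for i
    by (simp add: sum_3)
  then show ?thesis
    unfolding Delta33_def by (simp add: algebra_simps)
qed

lemma finite_Delta33: "finite Delta33"
proof (rule finite_subset)
  show "Delta33 \<subseteq> (\<lambda>(a, b, c). vector [a, b, c]) ` ({..3} \<times> {..3} \<times> {..3})"
  proof
    fix \<alpha> assume "\<alpha> \<in> Delta33"
    then show "\<alpha> \<in> (\<lambda>(a, b, c). vector [a, b, c]) ` ({..3} \<times> {..3} \<times> {..3})"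
      by (intro image_eqI[of _ _ "(\<alpha> $ 1, \<alpha> $ 2, \<alpha> $ 3)"])
        (auto simp: Delta33_def vec_eq_iff forall_3)
  qed
qed simp

lemma cubic_with_ncoeffs:
  fixes c :: "nat^3 \<Rightarrow> real"
  obtains f :: poly3 where "Poly_Mapping.keys f \<subseteq> Delta33" "\<And>\<alpha>. \<alpha> \<in> Delta33 \<Longrightarrow> ncoeff f \<alpha> = c \<alpha>"
proof -
  define g where "g \<alpha> = (if \<alpha> \<in> Delta33 then c \<alpha> / (\<Prod>i\<in>UNIV. fact (\<alpha> $ i)) else 0)" for \<alpha>
  have "finite {\<alpha>. g \<alpha> \<noteq> 0}"
    by (rule finite_subset[OF _ finite_Delta33]) (auto simp: g_def split: if_splits)
  then have lookup: "Poly_Mapping.lookup (Abs_poly_mapping g) = g"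
    by simp
  show ?thesis
  proof (rule that)
    show "Poly_Mapping.keys (Abs_poly_mapping g) \<subseteq> Delta33"
      by (auto simp: in_keys_iff lookup g_def split: if_splits)
    show "ncoeff (Abs_poly_mapping g) \<alpha> = c \<alpha>" if "\<alpha> \<in> Delta33" for \<alpha>
      using that by (simp add: ncoeff_def lookup g_def)
  qed
qed

lemma slice_nth: "slice f i $ j $ k = ncoeff f (ee i + ee j + ee k)"
  by (simp add: slice_def)

lemma transpose_slice: "transpose (slice f i) = slice f i"
  by (simp add: transpose_def slice_def vec_eq_iff ac_simps)

lemma slice_in_pos_sym_matrices: "f \<in> L33_plus \<Longrightarrow> slice f i \<in> pos_sym_matrices"
  using ee_sum_in_Delta33
  by (auto simp: pos_sym_matrices_def L33_plus_def transpose_slice slice_nth simp flip: slice_def)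

lemma log_Rs_eq:
  "log_Rs f = ((ln (Rij f 1 1), ln (Rij f 1 2), ln (Rij f 1 3)),
    (ln (Rij f 2 1), ln (Rij f 2 2), ln (Rij f 2 3)), (ln (Rij f 3 1), ln (Rij f 3 2), ln (Rij f 3 3)))"
proof -
  have univ: "{1, 2, 3} = (UNIV :: 3 set)" "{2, 1, 3} = (UNIV :: 3 set)" "{3, 1, 2} = (UNIV :: 3 set)"
    by (auto simp: UNIV_3)
  have "log_ratios (slice f i) = (ln (Rij f i 1), ln (Rij f i 2), ln (Rij f i 3))" for i
    unfolding log_ratios_def PX_def PY_def PZ_def slice_nth univ[THEN Rij_eq]
    by (simp add: add.assoc add.commute[of "ee 2" "ee 1"] add.commute[of "ee 3" "ee 1"] add.commute[of "ee 3" "ee 2"])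
  then show ?thesis
    by (simp add: log_Rs_def)
qed

lemma Rij_pos: "f \<in> L33_plus \<Longrightarrow> Rij f i j > 0"
  using ee_sum_in_Delta33 by (simp add: L33_plus_def Rij_def Let_def)

text \<open>
  For a cubic, the coefficients in the two defects cancel: both products in the first relation equal
  \<open>c\<^sub>1\<^sub>1\<^sub>2 c\<^sub>2\<^sub>3\<^sub>3 / c\<^sub>1\<^sub>2\<^sub>3\<^sup>2\<close>, and both in the second equal \<open>c\<^sub>1\<^sub>2\<^sub>2 c\<^sub>1\<^sub>3\<^sub>3 / c\<^sub>1\<^sub>2\<^sub>3\<^sup>2\<close>.
  Conversely, scaling the variables allows \<open>c\<^sub>1\<^sub>1\<^sub>2 = c\<^sub>1\<^sub>1\<^sub>3 = c\<^sub>1\<^sub>2\<^sub>3 = 1\<close>. The ratios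
  other than \<open>R\<^sub>2\<^sub>3\<close> and \<open>R\<^sub>3\<^sub>2\<close> then determine the remaining seven coefficients one after
  the other, and the two relations give \<open>R\<^sub>2\<^sub>3\<close> and \<open>R\<^sub>3\<^sub>2\<close>.
\<close>

lemma log_Rs_image:
  "log_Rs ` L33_plus = {U \<in> log_region \<times> log_region \<times> log_region. gluing_defect U = 0}"
proof (intro antisym subsetI)
  fix U assume "U \<in> log_Rs ` L33_plus"
  then obtain f where f: "f \<in> L33_plus" and U: "U = log_Rs f"
    by auto
  have "U \<in> log_region \<times> log_region \<times> log_region"
    using slice_in_pos_sym_matrices[OF f] log_ratios_image by (auto simp: U log_Rs_def)
  moreover have "gluing_defect U = 0"
  proof -
    have pos: "ncoeff f (ee i + ee j + ee k) > 0" for i j k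
      using f ee_sum_in_Delta33 by (simp add: L33_plus_def)
    have nonzero: "ncoeff f (ee i + ee j + ee k) \<noteq> 0" for i j k
      using pos[of i j k] by simp
    have "log_ratios (slice f i) =
       (ln (slice f i $ 1 $ 1) + ln (slice f i $ 2 $ 3) - ln (slice f i $ 1 $ 2) - ln (slice f i $ 1 $ 3),
        ln (slice f i $ 2 $ 2) + ln (slice f i $ 1 $ 3) - ln (slice f i $ 1 $ 2) - ln (slice f i $ 2 $ 3),
        ln (slice f i $ 3 $ 3) + ln (slice f i $ 1 $ 2) - ln (slice f i $ 1 $ 3) - ln (slice f i $ 2 $ 3))" for i
      by (simp add: log_ratios_def PX_def PY_def PZ_def slice_nth ln_div ln_mult pos nonzero)
    then show ?thesis
      by (simp add: U log_Rs_def gluing_defect_def slice_nth ac_simps zero_prod_def)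
  qed
  ultimately show "U \<in> {U \<in> log_region \<times> log_region \<times> log_region. gluing_defect U = 0}"
    by simp
next
  fix U assume U: "U \<in> {U \<in> log_region \<times> log_region \<times> log_region. gluing_defect U = 0}"
  obtain a1 a2 a3 b1 b2 b3 c1 c2 c3 where U_eq: "U = ((a1, a2, a3), (b1, b2, b3), (c1, c2, c3))"
    by (metis prod.exhaust)
  have glue: "a3 + c1 = b1 + b3" "c2 + b3 = a2 + a3"
    using U by (auto simp: U_eq gluing_defect_def zero_prod_def)
  \<comment> \<open>The branches list the logarithms of \<open>c\<^sub>1\<^sub>1\<^sub>1\<close>; of \<open>c\<^sub>1\<^sub>1\<^sub>2\<close> and \<open>c\<^sub>1\<^sub>1\<^sub>3\<close>; of \<open>c\<^sub>1\<^sub>2\<^sub>2\<close>, \<open>c\<^sub>1\<^sub>2\<^sub>3\<close>, \<open>c\<^sub>1\<^sub>3\<^sub>3\<close>;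
    and of \<open>c\<^sub>2\<^sub>2\<^sub>2\<close>, \<open>c\<^sub>2\<^sub>2\<^sub>3\<close>, \<open>c\<^sub>2\<^sub>3\<^sub>3\<close>, \<open>c\<^sub>3\<^sub>3\<^sub>3\<close>.\<close>
  define L :: "nat^3 \<Rightarrow> real" where "L \<alpha> =
    (if \<alpha> $ 1 = 3 then a1
     else if \<alpha> $ 1 = 2 then 0
     else if \<alpha> $ 1 = 1 then (if \<alpha> $ 2 = 2 then a2 else if \<alpha> $ 2 = 1 then 0 else a3)
     else (if \<alpha> $ 2 = 3 then b2 + 2 * a2 + b1 else if \<alpha> $ 2 = 2 then a2 + b1
           else if \<alpha> $ 2 = 1 then a3 + c1 else c3 + 2 * a3 + c1))" for \<alpha>
  obtain f where keys: "Poly_Mapping.keys f \<subseteq> Delta33"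
    and f: "\<And>\<alpha>. \<alpha> \<in> Delta33 \<Longrightarrow> ncoeff f \<alpha> = exp (L \<alpha>)"
    using cubic_with_ncoeffs[of "\<lambda>\<alpha>. exp (L \<alpha>)"] by metis
  have slice: "slice f i $ j $ k = exp (L (ee i + ee j + ee k))" for i j k
    using f[OF ee_sum_in_Delta33] by (simp add: slice_nth)
  have ratios: "log_Rs f = U"
    using glue
    by (simp add: U_eq log_Rs_def log_ratios_def PX_def PY_def PZ_def slice L_def ee_nth ln_div ln_mult)
  have "at_most_one_pos_eigenvalue (slice f i)" for i
  proof -
    have "\<forall>i. log_ratios (slice f i) \<in> log_region"
      using U ratios by (auto simp: forall_3 log_Rs_def)
    then show ?thesis
      using at_most_one_pos_eigenvalue_iff_log_ratios[OF transpose_slice] by (simp add: slice)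
  qed
  then have "f \<in> L33_plus"
    using keys f by (simp add: L33_plus_def slice_def)
  then show "U \<in> log_Rs ` L33_plus"
    using ratios by blast
qed


section \<open>The duality formula\<close>

definition weight :: "real \<Rightarrow> real \<Rightarrow> real \<Rightarrow> real \<times> real \<times> real \<Rightarrow> real" where
  "weight a b c = (\<lambda>(u, v, w). a * u + b * v + c * w)"

lemma h_eq_support: "h a b c = (SUP u\<in>log_region. ereal (weight a b c u))"
proof -
  have "PX P powr a * PY P powr b * PZ P powr c = exp (weight a b c (log_ratios P))"
    if "P \<in> pos_sym_matrices" for P
  proof -
    have "0 < PX P" "0 < PY P" "0 < PZ P"
      using that by (auto simp: pos_sym_matrices_def PX_def PY_def PZ_def)
    then show ?thesis
      by (simp add: powr_def weight_def log_ratios_def exp_add)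
  qed
  then have "h a b c = elog (SUP P\<in>pos_sym_matrices. ereal (exp (weight a b c (log_ratios P))))"
    by (simp add: h_def)
  also have "\<dots> = (SUP P\<in>pos_sym_matrices. ereal (weight a b c (log_ratios P)))"
    by (rule elog_SUP_exp)
  finally show ?thesis
    by (simp add: image_image flip: log_ratios_image)
qed

lemma nonpos_in_log_region:
  assumes "u \<le> 0" "v \<le> 0" "w \<le> 0"
  shows "(u, v, w) \<in> log_region"
proof -
  define x y z where "x = exp u" and "y = exp v" and "z = exp w"
  have *: "0 < x" "x \<le> 1" "0 < y" "y \<le> 1" "0 < z" "z \<le> 1"
    using assms by (auto simp: x_def y_def z_def)
  have "0 \<le> (1 - x) * (1 - y) + (1 - x * y) * (1 - z)"
    using * by (intro add_nonneg_nonneg mult_nonneg_nonneg) (auto simp: mult_le_one)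
  then have "x + y + z \<le> x * y * z + 2"
    by (simp add: algebra_simps)
  then show ?thesis
    using assms by (simp add: log_region_def x_def y_def z_def exp_add)
qed

text \<open>
  At the point with all coordinates \<open>-1\<close> both defects vanish, and they can be varied independently
  through the first and second coordinate of the third triple, each of which occurs in one defect only.
\<close>

lemma gluing_slater: "0 \<in> interior (gluing_defect ` (log_region \<times> log_region \<times> log_region))"
proof (rule interiorI)
  show "open ({-1<..<1::real} \<times> {-1<..<1::real})"
    by (intro open_Times) auto
  show "0 \<in> {-1<..<1::real} \<times> {-1<..<1::real}"
    by (simp add: zero_prod_def)
  show "{-1<..<1} \<times> {-1<..<1} \<subseteq> gluing_defect ` (log_region \<times> log_region \<times> log_region)"
  proof clarify
    fix s t :: real assume "s \<in> {-1<..<1}" "t \<in> {-1<..<1}"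
    then show "(s, t) \<in> gluing_defect ` (log_region \<times> log_region \<times> log_region)"
      by (intro image_eqI[of _ _ "((-1, -1, -1), (-1, -1, -1), (-1 + s, -1 + t, -1))"])
        (auto simp: gluing_defect_def intro!: nonpos_in_log_region)
  qed
qed

lemma UNIV_9: "(UNIV :: 9 set) = {1, 2, 3, 4, 5, 6, 7, 8, 9}"
proof (rule sym, rule card_subset_eq)
  show "card {1, 2, 3, 4, 5, 6, 7, 8, 9 :: 9} = card (UNIV :: 9 set)"
    by simp
qed auto

definition total_weight where
  "total_weight l = (\<lambda>(u, v, w). weight (l $ 1) (l $ 2) (l $ 3) u
    + weight (l $ 4) (l $ 5) (l $ 6) v + weight (l $ 7) (l $ 8) (l $ (9::9)) w)"

lemma linear_total_weight: "linear (total_weight l)"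
  by (rule linearI) (auto simp: total_weight_def weight_def algebra_simps)

lemma H3_eq_SUP: "H3 l = (SUP U\<in>log_Rs ` L33_plus. ereal (total_weight l U))"
proof -
  have "(\<Prod>m\<in>UNIV. Rvec f $ m powr (l $ m)) = exp (total_weight l (log_Rs f))" if "f \<in> L33_plus" for f
  proof -
    have "Rvec f $ m > 0" for m
    proof -
      have "m \<in> {1, 2, 3, 4, 5, 6, 7, 8, 9}"
        using UNIV_9 by blast
      then show ?thesis
        using Rij_pos[OF that] by (auto simp: Rvec_nth)
    qed
    then have "(\<Prod>m\<in>UNIV. Rvec f $ m powr (l $ m)) = exp (\<Sum>m\<in>UNIV. l $ m * ln (Rvec f $ m))"
      by (simp add: powr_def exp_sum less_imp_neq[symmetric])
    also have "(\<Sum>m\<in>UNIV. l $ m * ln (Rvec f $ m)) = total_weight l (log_Rs f)"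
      unfolding UNIV_9 by (simp add: Rvec_nth total_weight_def weight_def log_Rs_eq)
    finally show ?thesis .
  qed
  then have "H3 l = elog (SUP f\<in>L33_plus. ereal (exp (total_weight l (log_Rs f))))"
    by (simp add: H3_def)
  also have "\<dots> = (SUP f\<in>L33_plus. ereal (total_weight l (log_Rs f)))"
    by (rule elog_SUP_exp)
  finally show ?thesis
    by (simp add: image_image)
qed

theorem theorem6p2:
  fixes l :: "real^9"
  assumes "\<And>m. l $ m \<ge> 0"
  shows "H3 l =
    (INF (\<mu>, \<nu>) \<in> (UNIV :: (real \<times> real) set).
        h (l $ 1) (l $ 2 - \<nu>) (l $ 3 + \<mu> - \<nu>)
      + h (l $ 4 - \<mu>) (l $ 5) (l $ 6 - \<mu> + \<nu>)
      + h (l $ 7 + \<mu>) (l $ 8 + \<nu>) (l $ 9))"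
proof -
  let ?K = "log_region"
  have "H3 l = (SUP U\<in>{U \<in> ?K \<times> ?K \<times> ?K. gluing_defect U = 0}. ereal (total_weight l U))"
    by (simp add: H3_eq_SUP log_Rs_image)
  also have "\<dots> = (INF y. SUP U\<in>?K \<times> ?K \<times> ?K. ereal (total_weight l U + y \<bullet> gluing_defect U))"
    by (intro lagrange_duality_linear_constraint convex_Times convex_log_region linear_gluing_defect
        linear_total_weight gluing_slater)
  also have "\<dots> = (INF (\<mu>, \<nu>). h (l $ 1) (l $ 2 - \<nu>) (l $ 3 + \<mu> - \<nu>)
      + h (l $ 4 - \<mu>) (l $ 5) (l $ 6 - \<mu> + \<nu>)
      + h (l $ 7 + \<mu>) (l $ 8 + \<nu>) (l $ 9))"
  proof (rule INF_cong[OF refl], clarify)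
    fix \<mu> \<nu> :: real
    define p q r where "p = weight (l $ 1) (l $ 2 - \<nu>) (l $ 3 + \<mu> - \<nu>)"
      and "q = weight (l $ 4 - \<mu>) (l $ 5) (l $ 6 - \<mu> + \<nu>)"
      and "r = weight (l $ 7 + \<mu>) (l $ 8 + \<nu>) (l $ 9)"
    have ne: "?K \<noteq> {}"
      using nonpos_in_log_region[of 0 0 0] by auto
    have "total_weight l U + (\<mu>, \<nu>) \<bullet> gluing_defect U = (case U of (u, v, w) \<Rightarrow> p u + (q v + r w))" for U
      by (auto simp: total_weight_def weight_def gluing_defect_def p_def q_def r_def algebra_simps
          split: prod.splits)
    then have "(SUP U\<in>?K \<times> ?K \<times> ?K. ereal (total_weight l U + (\<mu>, \<nu>) \<bullet> gluing_defect U)) =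
        (SUP (u, V)\<in>?K \<times> ?K \<times> ?K. ereal (p u + (case V of (v, w) \<Rightarrow> q v + r w)))"
      by (simp add: case_prod_unfold)
    also have "\<dots> = (SUP u\<in>?K. ereal (p u)) + (SUP V\<in>?K \<times> ?K. ereal (case V of (v, w) \<Rightarrow> q v + r w))"
      using ne by (intro SUP_ereal_Times_add) auto
    also have "(SUP V\<in>?K \<times> ?K. ereal (case V of (v, w) \<Rightarrow> q v + r w)) =
        (SUP v\<in>?K. ereal (q v)) + (SUP w\<in>?K. ereal (r w))"
      using SUP_ereal_Times_add[OF ne ne, of q r] by (simp add: case_prod_unfold)
    finally show "(SUP U\<in>?K \<times> ?K \<times> ?K. ereal (total_weight l U + (\<mu>, \<nu>) \<bullet> gluing_defect U)) =
        h (l $ 1) (l $ 2 - \<nu>) (l $ 3 + \<mu> - \<nu>) + h (l $ 4 - \<mu>) (l $ 5) (l $ 6 - \<mu> + \<nu>)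
        + h (l $ 7 + \<mu>) (l $ 8 + \<nu>) (l $ 9)"
      by (simp add: h_eq_support p_def q_def r_def add.assoc)
  qed
  finally show ?thesis .
qed

end
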